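(* Consider the predictive queueing system described in the context, operated under a fully-efficient predictive scheduling policy, and for each user $n$ the associated non-predictive queue $\hat Q_n(t)$ defined in the context. Suppose that for each $n$ the queues $\{Q_n^{(d)}(t)\}_{d=-1}^{D_n-1}$ and $\hat Q_n(t)$ use the same queueing discipline, and that the arrival and service processes are such that the steady-state delay distribution of $\hat Q_n(t)$ does not depend on the initial value $\hat Q_n(0)$ nor on the time delay (shift by $D_n$ slots) in the arrival process. Let $\pi_{nk}$ be the steady-state probability that a user-$n$ packet experiences a delay of $k$ slots in the original system without prediction. Then the delay reduction $R(\boldsymbol D)$ offered by predictive scheduling with prediction window vector $\boldsymbol D=(D_1,\dots,D_N)$ is $$R(\boldsymbol D)=\frac{\sum_{n=1}^N\lambda_n\Big(\sum_{1\le k\le D_n}k\,\pi_{nk}+D_n\sum_{k\ge 1}\pi_{n,k+D_n}\Big)}{\sum_{n=1}^N\lambda_n}.$$ In particular, if $W_{\mathrm{tot}}<\infty$, then the average system delay goes to zero as $D_n\to\infty$ for all $n$, i.e. $$\lim_{\boldsymbol D\to\infty}R(\boldsymbol D)=W_{\mathrm{tot}},$$ where $\boldsymbol D\to\infty$ means $D_n\to\infty$ for all $n$.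
   Context: Time is slotted, $t\in\{0,1,2,\dots\}$, and $[x]^+=\max(x,0)$. There are $N$ users served by one server. $A_n(t)$ is the number of packets of user $n$ arriving in slot $t$, with $0\le A_n(t)\le A_{\max}$; the vectors $(A_1(t),\dots,A_N(t))$ are i.i.d. over $t$, with $\mathbb E\{A_n(t)\}=\lambda_n$. $\mu_n(t)\ge 0$ is the total service rate allocated to user $n$ in slot $t$. User $n$ has a prediction window of size $D_n\ge 0$ (an integer): at time $t$ the server knows $A_n(t),\dots,A_n(t+D_n-1)$ and may serve these future arrivals in the current slot. $\mu_n^{(d)}(t)\ge 0$, $0\le d\le D_n-1$, is the rate allocated in slot $t$ to the packets arriving in slot $t+d$, and $\mu_n^{(-1)}(t)\ge 0$ is the rate allocated to packets already in the system; $\sum_{d=-1}^{D_n-1}\mu_n^{(d)}(t)\le\mu_n(t)$. Prediction queues: for $0\le d\le D_n-1$, $Q_n^{(d)}(t)$ is the number of not-yet-served packets among the arrivals of slot $t+d$; $Q_n^{(-1)}(t)$ is the actual backlog in the system. Initially $Q_n^{(-1)}(0)=0$ and $Q_n^{(d)}(0)=A_n(d)$ for $0\le d\le D_n-1$. They evolve by - $Q_n^{(D_n-1)}(t+1)=A_n(t+D_n)$; - $Q_n^{(d)}(t+1)=[Q_n^{(d+1)}(t)-\mu_n^{(d+1)}(t)]^+$ for $0\le d\le D_n-2$; - $Q_n^{(-1)}(t+1)=[Q_n^{(-1)}(t)-\mu_n^{(-1)}(t)]^+ +[Q_n^{(0)}(t)-\mu_n^{(0)}(t)]^+$. If $D_n=0$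 for all $n$ (the original system without prediction) there is only the queue $Q_n(t)=Q_n^{(-1)}(t)$, with $Q_n(0)=0$ and $Q_n(t+1)=[Q_n(t)-\mu_n(t)]^+ +A_n(t)$. Define $Q_n^{\mathrm{sum}}(t)=\sum_{d=-1}^{D_n-1}Q_n^{(d)}(t)$. A predictive scheduling policy is fully-efficient if for every user $n$ and every $t$: (i) $\sum_{d=-1}^{D_n-1}\mu_n^{(d)}(t)=\mu_n(t)$; and (ii) whenever there exists $d$ with $\mu_n^{(d)}(t)>Q_n^{(d)}(t)$, then $\mu_n^{(d')}(t)\ge Q_n^{(d')}(t)$ for all $d'\ne d$. The queue $\hat Q_n(t)$ is a single queue without prediction with $\hat Q_n(0)=\sum_{t=0}^{D_n-1}A_n(t)$, arrivals $\hat A_n(t)=A_n(t+D_n)$, service $\hat\mu_n(t)=\sum_{d=-1}^{D_n-1}\mu_n^{(d)}(t)$, and $\hat Q_n(t+1)=[\hat Q_n(t)-\hat\mu_n(t)]^+ +\hat A_n(t)$. If instead one takes $\hat Q_n(0)=0$ and $\hat A_n(t)=A_n(t)$, then $\hat Q_n(t)$ is exactly the queueing process of the original system without prediction. Queueing discipline: at each time the packets in $\{Q_n^{(d)}(t)\}_{d=-1}^{D_n-1}$ are listed in order $p_1,\dots,p_{Q_n^{\mathrm{sum}}(t)}$, those of $Q_n^{(-1)}(t)$ first, then those of $Q_n^{(0)}(t)$, and so on; packets of $\hat Q_n(t)$ are listed from the head of the line. A discipline (e.g. FIFO, LIFO) is a rule selecting which packets to serve according to this order; the systems use the same discipline if the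 same rule is applied to the ordered lists. Delay: the delay of a packet in a queue is its service slot minus its arrival slot to that queue. In the predictive system the delay of a packet is the delay it experiences in the actual queue $Q_n^{(-1)}$ (relative to its true arrival slot), and is $0$ if it is served before entering $Q_n^{(-1)}$. Steady-state delay probabilities are understood to exist; $\pi^{(D_n)}_{nk}$ denotes the steady-state probability that a user-$n$ packet has delay $k$ in the predictive system. The average delay of the original system is $$W_{\mathrm{tot}}=\frac{\sum_{n=1}^N\lambda_n\sum_{k\ge 0}k\,\pi_{nk}}{\sum_{n=1}^N\lambda_n},$$ the average delay of the predictive system is given by the same formula with $\pi^{(D_n)}_{nk}$ in place of $\pi_{nk}$, and $R(\boldsymbol D)$ is $W_{\mathrm{tot}}$ minus the average delay of the predictive system (a difference understood when these averages are finite). *)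

theory Defs
  imports "HOL-Probability.Probability"
begin

text \<open>
  Rates and backlogs count whole packets, so they are of type \<^typ>\<open>nat\<close>; the truncated subtraction of
  \<^typ>\<open>nat\<close> is the operation $[x - y]^+$.
  Apart from the probabilistic notions, everything is defined for one user and one sample path.
  A packet is identified by the slot in which it arrives to the queue under consideration together
  with its position in that slot's batch; packets in a queue at time 0 without an arrival slot are
  called initial.
\<close>

datatype packet = Initial nat | Arrival nat nat

definition batch :: "nat \<Rightarrow> nat \<Rightarrow> packet list" where
  "batch t m = map (Arrival t) [0..<m]"


section \<open>Disciplines\<close>

text \<open>
  \<open>sel l m\<close> is the set of positions (counted from the head of the line, starting at 0) that are served
  when \<open>m\<close> out of \<open>l\<close> listed packets are served. For instance, FIFO is \<open>\<lambda>l m. {..<m}\<close> and LIFO is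
  \<open>\<lambda>l m. {l - m..<l}\<close>.
\<close>

definition discipline :: "(nat \<Rightarrow> nat \<Rightarrow> nat set) \<Rightarrow> bool" where
  "discipline sel \<longleftrightarrow> (\<forall>l m. m \<le> l \<longrightarrow> sel l m \<subseteq> {..<l} \<and> card (sel l m) = m)"


section \<open>A single queue without prediction\<close>

text \<open>
  \<open>q\<close> is the initial backlog, \<open>a\<close> the arrival path and \<open>s\<close> the service path. Arrivals of slot \<open>t\<close> are
  first available for service in slot \<open>t + 1\<close>.
\<close>

primrec line :: "(nat \<Rightarrow> nat \<Rightarrow> nat set) \<Rightarrow> nat \<Rightarrow> (nat \<Rightarrow> nat) \<Rightarrow> (nat \<Rightarrow> nat) \<Rightarrow> nat \<Rightarrow> packet list" where
  "line sel q a s 0 = map Initial [0..<q]"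
| "line sel q a s (Suc t) =
    (let xs = line sel q a s t
     in nths xs (- sel (length xs) (min (s t) (length xs))) @ batch t (a t))"

definition served :: "(nat \<Rightarrow> nat \<Rightarrow> nat set) \<Rightarrow> nat \<Rightarrow> (nat \<Rightarrow> nat) \<Rightarrow> (nat \<Rightarrow> nat) \<Rightarrow> nat \<Rightarrow> packet set" where
  "served sel q a s t =
    (let xs = line sel q a s t
     in set (nths xs (sel (length xs) (min (s t) (length xs)))))"

lemma length_nths_compl_discipline:
  assumes "discipline sel" "m \<le> length xs"
  shows "length (nths xs (- sel (length xs) m)) = length xs - m"
proof -
  have *: "sel (length xs) m \<subseteq> {..<length xs}" "card (sel (length xs) m) = m"
    using assms by (auto simp: discipline_def)
  have "{i. i < length xs \<and> i \<in> - sel (length xs) m} = {..<length xs} - sel (length xs) m"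
    by auto
  then show ?thesis
    using * by (simp add: length_nths card_Diff_subset finite_subset[OF *(1)])
qed

text \<open>The backlog obeys the queueing recursion $Q(t+1) = [Q(t) - s(t)]^+ + a(t)$.\<close>

lemma length_line:
  assumes "discipline sel"
  shows "length (line sel q a s 0) = q"
    and "length (line sel q a s (Suc t)) = (length (line sel q a s t) - s t) + a t"
  using length_nths_compl_discipline[OF assms, of "min (s t) (length (line sel q a s t))"
      "line sel q a s t"]
  by (simp_all add: Let_def batch_def)

definition delay :: "(nat \<Rightarrow> nat \<Rightarrow> nat set) \<Rightarrow> nat \<Rightarrow> (nat \<Rightarrow> nat) \<Rightarrow> (nat \<Rightarrow> nat) \<Rightarrow> nat \<Rightarrow> nat \<Rightarrow> nat \<Rightarrow> bool" where
  "delay sel q a s t i k \<longleftrightarrow> (\<exists>r\<ge>t. Arrival t i \<in> served sel q a s r \<and> k = r - t)"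


section \<open>Prediction queues\<close>

definition window :: "nat \<Rightarrow> int set" where
  "window D = {-1..int D - 1}"

text \<open>\<open>\<nu> d t\<close> is the rate $\mu^{(d)}(t)$.\<close>

primrec pred_backlog :: "nat \<Rightarrow> (nat \<Rightarrow> nat) \<Rightarrow> (int \<Rightarrow> nat \<Rightarrow> nat) \<Rightarrow> nat \<Rightarrow> int \<Rightarrow> nat" where
  "pred_backlog D a \<nu> 0 = (\<lambda>d. if 0 \<le> d \<and> d \<le> int D - 1 then a (nat d) else 0)"
| "pred_backlog D a \<nu> (Suc t) =
    (let left = (\<lambda>d. pred_backlog D a \<nu> t d - \<nu> d t)
     in (\<lambda>d. if D = 0 then (if d = -1 then left (-1) + a t else 0)
             else if d = -1 then left (-1) + left 0
             else if 0 \<le> d \<and> d \<le> int D - 2 then left (d + 1)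
             else if d = int D - 1 then a (t + D)
             else 0))"

definition fully_efficient ::
  "nat \<Rightarrow> (nat \<Rightarrow> nat) \<Rightarrow> (nat \<Rightarrow> nat) \<Rightarrow> (int \<Rightarrow> nat \<Rightarrow> nat) \<Rightarrow> bool" where
  "fully_efficient D a \<mu> \<nu> \<longleftrightarrow>
    (\<forall>t. (\<Sum>d\<in>window D. \<nu> d t) = \<mu> t \<and>
         (\<forall>d\<in>window D. \<nu> d t > pred_backlog D a \<nu> t d \<longrightarrow>
            (\<forall>d'\<in>window D - {d}. \<nu> d' t \<ge> pred_backlog D a \<nu> t d')))"

text \<open>
  The packets behind the backlogs. \<open>selected sel D m L\<close> are the packets picked by the discipline from
  the concatenation of the lists \<open>L (-1), L 0, \<dots>, L (D - 1)\<close> when list \<open>L d\<close> is offered the rate \<open>m d\<close>.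
\<close>

definition selected ::
  "(nat \<Rightarrow> nat \<Rightarrow> nat set) \<Rightarrow> nat \<Rightarrow> (int \<Rightarrow> nat) \<Rightarrow> (int \<Rightarrow> packet list) \<Rightarrow> packet set" where
  "selected sel D m L =
    (let xs = concat (map L [-1..int D - 1])
     in set (nths xs (sel (length xs) (\<Sum>d\<in>window D. min (m d) (length (L d))))))"

primrec pred_line :: "(nat \<Rightarrow> nat \<Rightarrow> nat set) \<Rightarrow> nat \<Rightarrow> (nat \<Rightarrow> nat) \<Rightarrow> (int \<Rightarrow> nat \<Rightarrow> nat) \<Rightarrow> nat \<Rightarrow>
    int \<Rightarrow> packet list" where
  "pred_line sel D a \<nu> 0 =
    (\<lambda>d. if 0 \<le> d \<and> d \<le> int D - 1 then batch (nat d) (a (nat d)) else [])"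
| "pred_line sel D a \<nu> (Suc t) =
    (let L = pred_line sel D a \<nu> t;
         left = (\<lambda>d. filter (\<lambda>p. p \<notin> selected sel D (\<lambda>d. \<nu> d t) L) (L d))
     in (\<lambda>d. if D = 0 then (if d = -1 then left (-1) @ batch t (a t) else [])
             else if d = -1 then left (-1) @ left 0
             else if 0 \<le> d \<and> d \<le> int D - 2 then left (d + 1)
             else if d = int D - 1 then batch (t + D) (a (t + D))
             else []))"

definition pred_served ::
  "(nat \<Rightarrow> nat \<Rightarrow> nat set) \<Rightarrow> nat \<Rightarrow> (nat \<Rightarrow> nat) \<Rightarrow> (int \<Rightarrow> nat \<Rightarrow> nat) \<Rightarrow> nat \<Rightarrow> packet set" where
  "pred_served sel D a \<nu> t = selected sel D (\<lambda>d. \<nu> d t) (pred_line sel D a \<nu> t)"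

text \<open>
  The rates are those realised by the discipline: the number of packets that it picks from the
  \<open>d\<close>-th prediction queue is the number of packets that the rate \<open>\<nu> d t\<close> removes from that queue.
\<close>

definition follows_discipline ::
  "(nat \<Rightarrow> nat \<Rightarrow> nat set) \<Rightarrow> nat \<Rightarrow> (nat \<Rightarrow> nat) \<Rightarrow> (int \<Rightarrow> nat \<Rightarrow> nat) \<Rightarrow> bool" where
  "follows_discipline sel D a \<nu> \<longleftrightarrow>
    (\<forall>t. \<forall>d\<in>window D.
       length (filter (\<lambda>p. p \<in> pred_served sel D a \<nu> t) (pred_line sel D a \<nu> t d)) =
       min (\<nu> d t) (pred_backlog D a \<nu> t d))"

lemma length_pred_line:
  assumes "follows_discipline sel D a \<nu>" "d \<in> window D"
  shows "length (pred_line sel D a \<nu> t d) = pred_backlog D a \<nu> t d"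
  using assms(2)
proof (induction t arbitrary: d)
  case 0
  then show ?case by (simp add: batch_def)
next
  case (Suc t)
  have left: "length (filter (\<lambda>p. p \<notin> pred_served sel D a \<nu> t) (pred_line sel D a \<nu> t e)) =
      pred_backlog D a \<nu> t e - \<nu> e t" if "e \<in> window D" for e
  proof -
    have "length (filter (\<lambda>p. p \<in> pred_served sel D a \<nu> t) (pred_line sel D a \<nu> t e)) =
        min (\<nu> e t) (pred_backlog D a \<nu> t e)"
      using assms(1) that by (simp add: follows_discipline_def)
    then show ?thesis
      using sum_length_filter_compl[of "\<lambda>p. p \<in> pred_served sel D a \<nu> t" "pred_line sel D a \<nu> t e"]
        Suc.IH[OF that] by (simp add: min_def split: if_splits)
  qed
  have "-1 \<in> window D" "D \<noteq> 0 \<Longrightarrow> 0 \<in> window D"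
    and "0 \<le> d \<Longrightarrow> d \<le> int D - 2 \<Longrightarrow> d + 1 \<in> window D"
    by (auto simp: window_def)
  moreover have "D = 0 \<Longrightarrow> d = -1" "d \<noteq> -1 \<Longrightarrow> 0 \<le> d" "d \<le> int D - 1"
    using Suc.prems by (auto simp: window_def)
  ultimately show ?case
    using left[of "-1"] left[of 0] left[of "d + 1"]
    by (cases "D = 0") (auto simp: Let_def batch_def pred_served_def)
qed

text \<open>
  Delay of the packet \<open>Arrival t i\<close>, where \<open>t\<close> is its true arrival slot: it counts only if the packet is
  served out of the actual queue, and is 0 if the packet is served as a predicted one.
\<close>

definition pred_delay ::
  "(nat \<Rightarrow> nat \<Rightarrow> nat set) \<Rightarrow> nat \<Rightarrow> (nat \<Rightarrow> nat) \<Rightarrow> (int \<Rightarrow> nat \<Rightarrow> nat) \<Rightarrow> nat \<Rightarrow> nat \<Rightarrow> nat \<Rightarrow> bool" where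
  "pred_delay sel D a \<nu> t i k \<longleftrightarrow>
    (\<exists>r. Arrival t i \<in> pred_served sel D a \<nu> r \<and>
         k = (if Arrival t i \<in> set (pred_line sel D a \<nu> r (-1)) then r - t else 0))"


section \<open>Steady-state delay distributions\<close>

definition delay_fraction :: "(nat \<Rightarrow> nat) \<Rightarrow> (nat \<Rightarrow> nat \<Rightarrow> nat \<Rightarrow> bool) \<Rightarrow> nat \<Rightarrow> nat \<Rightarrow> real" where
  "delay_fraction a dl k T =
    real (card {(t, i). t < T \<and> i < a t \<and> dl t i k}) / real (\<Sum>t<T. a t)"

text \<open>
  \<open>p k\<close> is the steady-state probability of delay \<open>k\<close>: almost surely, the long-run fraction of packets
  that have delay \<open>k\<close>. Packets that are never served count in the denominator only. The processes
  are indexed by slots first, as in \<open>a t \<omega>\<close>.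
\<close>

definition steady_delay ::
  "'w measure \<Rightarrow> (nat \<Rightarrow> 'w \<Rightarrow> nat) \<Rightarrow> ('w \<Rightarrow> nat \<Rightarrow> nat \<Rightarrow> nat \<Rightarrow> bool) \<Rightarrow> (nat \<Rightarrow> real) \<Rightarrow> bool" where
  "steady_delay M a dl p \<longleftrightarrow>
    (AE \<omega> in M. \<forall>k. (\<lambda>T. delay_fraction (\<lambda>t. a t \<omega>) (dl \<omega>) k T) \<longlonglongrightarrow> p k)"

definition queue_steady_delay ::
  "'w measure \<Rightarrow> (nat \<Rightarrow> nat \<Rightarrow> nat set) \<Rightarrow> ('w \<Rightarrow> nat) \<Rightarrow> (nat \<Rightarrow> 'w \<Rightarrow> nat) \<Rightarrow> (nat \<Rightarrow> 'w \<Rightarrow> nat) \<Rightarrow>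
    (nat \<Rightarrow> real) \<Rightarrow> bool" where
  "queue_steady_delay M sel q a s p \<longleftrightarrow>
    steady_delay M a (\<lambda>\<omega>. delay sel (q \<omega>) (\<lambda>t. a t \<omega>) (\<lambda>t. s t \<omega>)) p"

definition pred_steady_delay ::
  "'w measure \<Rightarrow> (nat \<Rightarrow> nat \<Rightarrow> nat set) \<Rightarrow> nat \<Rightarrow> (nat \<Rightarrow> 'w \<Rightarrow> nat) \<Rightarrow> (int \<Rightarrow> nat \<Rightarrow> 'w \<Rightarrow> nat) \<Rightarrow>
    (nat \<Rightarrow> real) \<Rightarrow> bool" where
  "pred_steady_delay M sel D a \<nu> p \<longleftrightarrow>
    steady_delay M a (\<lambda>\<omega>. pred_delay sel D (\<lambda>t. a t \<omega>) (\<lambda>d t. \<nu> d t \<omega>)) p"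

text \<open>
  The queue $\hat Q$ has initial backlog \<open>\<Sum>t<D. a t\<close>, arrivals \<open>a (t + D)\<close> and service
  \<open>\<Sum>d\<in>window D. \<nu> d t\<close>. Its steady-state delay distribution is required to be the same for every
  initial backlog, random or not, and for the arrivals with and without the shift by \<open>D\<close>.
\<close>

definition insensitive_delay ::
  "'w measure \<Rightarrow> (nat \<Rightarrow> nat \<Rightarrow> nat set) \<Rightarrow> nat \<Rightarrow> (nat \<Rightarrow> 'w \<Rightarrow> nat) \<Rightarrow> (int \<Rightarrow> nat \<Rightarrow> 'w \<Rightarrow> nat) \<Rightarrow> bool" where
  "insensitive_delay M sel D a \<nu> \<longleftrightarrow>
    (\<forall>q \<in> M \<rightarrow>\<^sub>M count_space UNIV. \<forall>q' \<in> M \<rightarrow>\<^sub>M count_space UNIV. \<forall>e\<in>{0, D}. \<forall>e'\<in>{0, D}. \<forall>p.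
       queue_steady_delay M sel q (\<lambda>t. a (t + e)) (\<lambda>t \<omega>. \<Sum>d\<in>window D. \<nu> d t \<omega>) p \<longleftrightarrow>
       queue_steady_delay M sel q' (\<lambda>t. a (t + e')) (\<lambda>t \<omega>. \<Sum>d\<in>window D. \<nu> d t \<omega>) p)"


section \<open>The multi-user system\<close>

definition iid_arrivals ::
  "'w measure \<Rightarrow> ('u::finite \<Rightarrow> nat \<Rightarrow> 'w \<Rightarrow> nat) \<Rightarrow> nat \<Rightarrow> ('u \<Rightarrow> real) \<Rightarrow> bool" where
  "iid_arrivals M A Amax lam \<longleftrightarrow>
    (\<forall>n t. \<forall>\<omega>\<in>space M. A n t \<omega> \<le> Amax) \<and>
    prob_space.indep_vars M (\<lambda>_. count_space UNIV) (\<lambda>t \<omega> n. A n t \<omega>) UNIV \<and>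
    (\<forall>t. distr M (count_space UNIV) (\<lambda>\<omega> n. A n t \<omega>) = distr M (count_space UNIV) (\<lambda>\<omega> n. A n 0 \<omega>)) \<and>
    (\<forall>n t. (\<integral>\<omega>. real (A n t \<omega>) \<partial>M) = lam n)"

text \<open>
  A predictive system with window vector \<open>D\<close>, operated under a fully-efficient policy, with
  steady-state delay probabilities \<open>pD n k\<close>, to which the insensitivity assumption applies.
\<close>

definition predictive_system ::
  "'w measure \<Rightarrow> ('u \<Rightarrow> nat \<Rightarrow> 'w \<Rightarrow> nat) \<Rightarrow> ('u \<Rightarrow> nat \<Rightarrow> 'w \<Rightarrow> nat) \<Rightarrow> ('u \<Rightarrow> nat \<Rightarrow> nat \<Rightarrow> nat set) \<Rightarrow>
    ('u \<Rightarrow> nat) \<Rightarrow> ('u \<Rightarrow> int \<Rightarrow> nat \<Rightarrow> 'w \<Rightarrow> nat) \<Rightarrow> ('u \<Rightarrow> nat \<Rightarrow> real) \<Rightarrow> bool" where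
  "predictive_system M A \<mu> sel D \<nu> pD \<longleftrightarrow>
    (\<forall>n.
      (\<forall>d\<in>window (D n). \<forall>t. \<nu> n d t \<in> M \<rightarrow>\<^sub>M count_space UNIV) \<and>
      (\<forall>\<omega>\<in>space M.
        fully_efficient (D n) (\<lambda>t. A n t \<omega>) (\<lambda>t. \<mu> n t \<omega>) (\<lambda>d t. \<nu> n d t \<omega>) \<and>
        follows_discipline (sel n) (D n) (\<lambda>t. A n t \<omega>) (\<lambda>d t. \<nu> n d t \<omega>)) \<and>
      insensitive_delay M (sel n) (D n) (A n) (\<nu> n) \<and>
      pred_steady_delay M (sel n) (D n) (A n) (\<nu> n) (pD n))"

text \<open>
  The average delay takes values in $[0, \infty]$; when every \<open>lam n\<close> is 0 it is 0 by the convention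
  for division by 0.
\<close>

definition avg_delay :: "('u::finite \<Rightarrow> real) \<Rightarrow> ('u \<Rightarrow> nat \<Rightarrow> real) \<Rightarrow> ennreal" where
  "avg_delay lam p =
    (\<Sum>n\<in>UNIV. ennreal (lam n) * (\<Sum>k. of_nat k * ennreal (p n k))) / ennreal (\<Sum>n\<in>UNIV. lam n)"

text \<open>Meaningful only if both averages are finite, since \<^const>\<open>enn2real\<close> maps $\infty$ to 0.\<close>

definition delay_reduction :: "('u::finite \<Rightarrow> real) \<Rightarrow> ('u \<Rightarrow> nat \<Rightarrow> real) \<Rightarrow> ('u \<Rightarrow> nat \<Rightarrow> real) \<Rightarrow> real" where
  "delay_reduction lam p pD = enn2real (avg_delay lam p) - enn2real (avg_delay lam pD)"

text \<open>On window vectors, \<^const>\<open>at_top\<close> says that all components tend to infinity.\<close>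

lemma eventually_at_top_windows:
  fixes P :: "('u::finite \<Rightarrow> nat) \<Rightarrow> bool"
  shows "eventually P at_top \<longleftrightarrow> (\<exists>K. \<forall>D. (\<forall>n. K \<le> D n) \<longrightarrow> P D)"
proof -
  have "eventually P at_top \<longleftrightarrow> (\<exists>f. \<forall>D\<ge>f. P D)"
    unfolding at_top_def
  proof (subst eventually_INF_base)
    fix f g :: "'u \<Rightarrow> nat"
    show "\<exists>h\<in>UNIV. principal {h..} \<le> inf (principal {f..}) (principal {g..})"
      by (rule bexI[of _ "sup f g"]) (auto simp: le_fun_def)
  qed (auto simp: eventually_principal)
  also have "\<dots> \<longleftrightarrow> (\<exists>K. \<forall>D. (\<forall>n. K \<le> D n) \<longrightarrow> P D)"
  proof
    assume "\<exists>f. \<forall>D\<ge>f. P D"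
    then obtain f where f: "\<And>D. f \<le> D \<Longrightarrow> P D" by auto
    have "f n \<le> Max (range f)" for n by simp
    then show "\<exists>K. \<forall>D. (\<forall>n. K \<le> D n) \<longrightarrow> P D"
      by (intro exI[of _ "Max (range f)"]) (auto intro!: f simp: le_fun_def intro: order_trans)
  next
    assume "\<exists>K. \<forall>D. (\<forall>n. K \<le> D n) \<longrightarrow> P D"
    then obtain K where "\<forall>D. (\<forall>n. K \<le> D n) \<longrightarrow> P D" by auto
    then show "\<exists>f. \<forall>D\<ge>f. P D"
      by (intro exI[of _ "\<lambda>_. K"]) (auto simp: le_fun_def)
  qed
  finally show ?thesis .
qed

end

theory Submission
  imports Defs
begin

text \<open>
  The concatenation of the prediction queues, with the actual queue in front, evolves exactly like the
  line of $\hat Q$: full efficiency makes the rates remove as many packets from it as one server with the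
  total rate would, and moving every list one window position forward does not change the concatenation.
  A packet that enters $\hat Q$ in slot \<open>t\<close> truly arrives in slot \<open>t + D\<close> and is served in the same
  slot in both systems, so a delay \<open>w\<close> in $\hat Q$ becomes the delay $[w - D]^+$ under prediction. Hence
  $\pi^{(D)}_k = \pi_{k+D}$ for $k \ge 1$, and the rest is the algebra of series.
\<close>

section \<open>Coupling the prediction queues with a single queue\<close>

definition pred_total ::
  "(nat \<Rightarrow> nat \<Rightarrow> nat set) \<Rightarrow> nat \<Rightarrow> (nat \<Rightarrow> nat) \<Rightarrow> (int \<Rightarrow> nat \<Rightarrow> nat) \<Rightarrow> nat \<Rightarrow> packet list" where
  "pred_total sel D a \<nu> t = concat (map (pred_line sel D a \<nu> t) [-1..int D - 1])"

text \<open>The packets visible at slot 0, listed by arrival slot: the true identities of the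
  initial packets of the single queue.\<close>

definition prefix_packets :: "nat \<Rightarrow> (nat \<Rightarrow> nat) \<Rightarrow> packet list" where
  "prefix_packets D a = concat (map (\<lambda>t. batch t (a t)) [0..<D])"

text \<open>Translates names of the single queue into names of the predictive system. The value at
  an out-of-range \<open>Initial j\<close> is a mere default: no such packet occurs in
  \<open>hat_line\<close>, whose initial backlog is the length of the prefix.\<close>

primrec true_packet :: "nat \<Rightarrow> (nat \<Rightarrow> nat) \<Rightarrow> packet \<Rightarrow> packet" where
  "true_packet D a (Initial j) =
    (if j < length (prefix_packets D a) then prefix_packets D a ! j else Initial j)"
| "true_packet D a (Arrival t i) = Arrival (t + D) i"

lemma upto_window: "[-1..int D - 1] = -1 # map int [0..<D]"
proof (induction D)
  case (Suc D)
  have "[-1..int (Suc D) - 1] = [-1..int D - 1] @ [int D]"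
    using upto_rec2[of "-1" "int D"] by simp
  then show ?case using Suc by simp
qed simp

lemma sum_list_window: "(\<Sum>d\<leftarrow>[-1..int D - 1]. f d) = (\<Sum>d\<in>window D. f d)"
  using sum_list_distinct_conv_sum_set[of "[-1..int D - 1]" f] by (simp add: window_def)

lemma distinct_batch [simp]: "distinct (batch t m)"
  by (auto simp: batch_def distinct_map inj_on_def)

lemma set_batch: "set (batch t m) = Arrival t ` {..<m}"
  by (auto simp: batch_def)

lemma length_prefix_packets: "length (prefix_packets D a) = (\<Sum>t<D. a t)"
  by (simp add: prefix_packets_def length_concat comp_def batch_def interv_sum_list_conv_sum_set_nat
      atLeast0LessThan)

lemma set_prefix_packets: "set (prefix_packets D a) = {Arrival t i |t i. t < D \<and> i < a t}"
  by (auto simp: prefix_packets_def set_batch)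

lemma distinct_prefix_packets: "distinct (prefix_packets D a)"
proof (induction D)
  case (Suc D)
  have "prefix_packets (Suc D) a = prefix_packets D a @ batch D (a D)"
    by (simp add: prefix_packets_def)
  then show ?case using Suc by (auto simp: set_prefix_packets set_batch)
qed (simp add: prefix_packets_def)

text \<open>The image of an initial packet either has an arrival slot below \<open>D\<close> or is
  no \<open>Arrival\<close> at all, so it cannot collide with a packet of slot
  \<open>t + D\<close>.\<close>

lemma true_packet_eq_Arrival_iff:
  "true_packet D a x = Arrival (t + D) i \<longleftrightarrow> x = Arrival t i"
proof (cases x)
  case (Initial j)
  have "prefix_packets D a ! j \<noteq> Arrival (t + D) i" if "j < length (prefix_packets D a)"
    using nth_mem[OF that] by (auto simp: set_prefix_packets)
  with Initial show ?thesis by simp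
qed auto

text \<open>The prediction queues drop served packets by identity, the single queue by position; in
  a list without repetitions the two agree.\<close>

lemma filter_notin_nths:
  assumes "distinct xs"
  shows "filter (\<lambda>x. x \<notin> set (nths xs S)) xs = nths xs (- S)"
proof -
  have "x \<notin> set (nths xs S) \<longleftrightarrow> x \<in> set (nths xs (- S))" if "x \<in> set xs" for x
    using that assms by (auto simp: set_nths in_set_conv_nth nth_eq_iff_index_eq)
  then have "filter (\<lambda>x. x \<notin> set (nths xs S)) xs = filter (\<lambda>x. x \<in> set (nths xs (- S))) xs"
    by (intro filter_cong) auto
  then show ?thesis using filter_in_nths[OF assms] by simp
qed

lemma pred_total_0: "pred_total sel D a \<nu> 0 = prefix_packets D a"
  unfolding pred_total_def prefix_packets_def upto_window
  by (auto simp: comp_def intro!: arg_cong[where f = concat])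

text \<open>Passing to the next slot only moves the cuts between consecutive lists, so their
  concatenation loses the served packets and gains the newly visible batch at its end.\<close>

lemma pred_total_Suc_filter:
  "pred_total sel D a \<nu> (Suc t) =
    filter (\<lambda>x. x \<notin> pred_served sel D a \<nu> t) (pred_total sel D a \<nu> t) @ batch (t + D) (a (t + D))"
proof (cases D)
  case 0
  then show ?thesis
    by (simp add: pred_total_def pred_served_def upto_window Let_def)
next
  case (Suc m)
  define left where
    "left = (\<lambda>d. filter (\<lambda>x. x \<notin> pred_served sel D a \<nu> t) (pred_line sel D a \<nu> t d))"
  have step: "pred_line sel D a \<nu> (Suc t) =
      (\<lambda>d. if d = -1 then left (-1) @ left 0
           else if 0 \<le> d \<and> d \<le> int D - 2 then left (d + 1)
           else if d = int D - 1 then batch (t + D) (a (t + D)) else [])"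
    using Suc unfolding left_def pred_served_def by (auto simp: Let_def fun_eq_iff)
  \<comment> \<open>With \<open>D = m + 1\<close>, the new lists are split at the last index, which
    receives the fresh batch; the old ones, in \<open>old\<close>, at the first two indices, which
    merge into the actual queue.\<close>
  have new: "[-1..int D - 1] = -1 # map int [0..<m] @ [int m]"
    unfolding upto_window Suc by simp
  have old: "[-1..int D - 1] = -1 # 0 # map (\<lambda>d. int d + 1) [0..<m]"
    unfolding upto_window Suc upt_conv_Cons[OF zero_less_Suc] map_Suc_upt[symmetric]
    by (simp add: comp_def add.commute)
  have "pred_total sel D a \<nu> (Suc t) =
      left (-1) @ left 0 @ concat (map (\<lambda>d. left (int d + 1)) [0..<m]) @ batch (t + D) (a (t + D))"
    unfolding pred_total_def step new using Suc
    by (auto simp: comp_def intro!: arg_cong[where f = concat])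
  also have "\<dots> = concat (map left [-1..int D - 1]) @ batch (t + D) (a (t + D))"
    unfolding old by (simp add: comp_def)
  also have "concat (map left [-1..int D - 1]) =
      filter (\<lambda>x. x \<notin> pred_served sel D a \<nu> t) (pred_total sel D a \<nu> t)"
    by (simp add: pred_total_def filter_concat left_def comp_def)
  finally show ?thesis .
qed

section \<open>Arrival slots of the packets in the prediction queues\<close>

lemma pred_total_arrival_bounds:
  "x \<in> set (pred_total sel D a \<nu> t) \<Longrightarrow> \<exists>u i. x = Arrival u i \<and> u < t + D"
proof (induction t arbitrary: x)
  case 0
  then show ?case by (auto simp: pred_total_0 set_prefix_packets)
next
  case (Suc t)
  then show ?case by (fastforce simp: pred_total_Suc_filter set_batch)
qed

text \<open>The fresh batch has arrival slot \<open>t + D\<close>, and all packets already listed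
  have smaller ones.\<close>

lemma distinct_pred_total: "distinct (pred_total sel D a \<nu> t)"
proof (induction t)
  case 0
  show ?case by (simp add: pred_total_0 distinct_prefix_packets)
next
  case (Suc t)
  then show ?case
    by (auto simp: pred_total_Suc_filter set_batch dest: pred_total_arrival_bounds)
qed

text \<open>The index of a waiting packet drops by one per slot, so current slot plus index stays
  its arrival slot until it reaches the actual queue. With \<open>D = 0\<close> a batch enters that
  queue directly.\<close>

lemma pred_line_arrivals:
  assumes "x \<in> set (pred_line sel D a \<nu> t d)"
  shows "\<exists>u i. x = Arrival u i \<and> (if d = -1 then u < t else int u = int t + d)"
  using assms
proof (induction t arbitrary: x d)
  case 0
  then show ?case by (auto simp: set_batch split: if_splits)
next
  case (Suc t)
  show ?case
  proof (cases "d = -1")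
    case True
    then have "x \<in> set (pred_line sel D a \<nu> t (-1)) \<or> x \<in> set (pred_line sel D a \<nu> t 0) \<or>
        x \<in> set (batch t (a t))"
      using Suc.prems by (auto simp: Let_def split: if_splits)
    then show ?thesis
      using True Suc.IH[of x "-1"] Suc.IH[of x 0] by (auto simp: set_batch)
  next
    case False
    then have "(0 \<le> d \<and> x \<in> set (pred_line sel D a \<nu> t (d + 1))) \<or>
        (d = int D - 1 \<and> x \<in> set (batch (t + D) (a (t + D))))"
      using Suc.prems by (auto simp: Let_def split: if_splits)
    then show ?thesis
      using False Suc.IH[of x "d + 1"] by (auto simp: set_batch)
  qed
qed

lemma mem_actual_queue_iff:
  assumes "Arrival u i \<in> set (pred_total sel D a \<nu> t)"
  shows "Arrival u i \<in> set (pred_line sel D a \<nu> t (-1)) \<longleftrightarrow> u < t"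
proof -
  obtain d where d: "d \<in> window D" "Arrival u i \<in> set (pred_line sel D a \<nu> t d)"
    using assms by (auto simp: pred_total_def window_def)
  show ?thesis
    using d pred_line_arrivals[OF d(2)] pred_line_arrivals[of "Arrival u i" sel D a \<nu> t "-1"]
    by (auto simp: window_def split: if_splits)
qed

section \<open>Full efficiency and the coupling\<close>

text \<open>The numerical content of full efficiency: if some rate exceeds its backlog, every queue
  is emptied and both sides are the total backlog; otherwise every rate is used up and both sides
  are the total rate.\<close>

lemma sum_min_eq_min_sum:
  fixes f g :: "'a \<Rightarrow> nat"
  assumes "finite I"
    and "\<And>i j. i \<in> I \<Longrightarrow> j \<in> I \<Longrightarrow> j \<noteq> i \<Longrightarrow> f i > g i \<Longrightarrow> f j \<ge> g j"
  shows "(\<Sum>i\<in>I. min (f i) (g i)) = min (\<Sum>i\<in>I. f i) (\<Sum>i\<in>I. g i)"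
proof (cases "\<exists>i\<in>I. f i > g i")
  case True
  then have ge: "f j \<ge> g j" if "j \<in> I" for j
    using assms(2) that by (metis less_imp_le)
  then have "(\<Sum>i\<in>I. min (f i) (g i)) = (\<Sum>i\<in>I. g i)"
    by (intro sum.cong) auto
  moreover have "(\<Sum>i\<in>I. g i) \<le> (\<Sum>i\<in>I. f i)"
    using ge by (rule sum_mono)
  ultimately show ?thesis by simp
next
  case False
  then have le: "f j \<le> g j" if "j \<in> I" for j
    using that by (auto simp: not_less)
  then have "(\<Sum>i\<in>I. min (f i) (g i)) = (\<Sum>i\<in>I. f i)"
    by (intro sum.cong) auto
  moreover have "(\<Sum>i\<in>I. f i) \<le> (\<Sum>i\<in>I. g i)"
    using le by (rule sum_mono)
  ultimately show ?thesis by simp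
qed

text \<open>\<open>follows_discipline\<close> identifies list lengths with backlogs; full efficiency
  then turns the number of served packets, a sum of minima, into what one server with the total rate
  would serve.\<close>

lemma pred_served_eq:
  assumes fe: "fully_efficient D a \<mu> \<nu>" and fd: "follows_discipline sel D a \<nu>"
  shows "pred_served sel D a \<nu> t =
    set (nths (pred_total sel D a \<nu> t)
      (sel (length (pred_total sel D a \<nu> t))
        (min (\<Sum>d\<in>window D. \<nu> d t) (length (pred_total sel D a \<nu> t)))))"
proof -
  let ?L = "pred_line sel D a \<nu> t"
  have len: "length (pred_total sel D a \<nu> t) = (\<Sum>d\<in>window D. length (?L d))"
    by (simp add: pred_total_def length_concat comp_def sum_list_window)
  have "(\<Sum>d\<in>window D. min (\<nu> d t) (length (?L d))) =
      min (\<Sum>d\<in>window D. \<nu> d t) (\<Sum>d\<in>window D. length (?L d))"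
  proof (rule sum_min_eq_min_sum)
    fix i j assume "i \<in> window D" "j \<in> window D" "j \<noteq> i" "\<nu> i t > length (?L i)"
    then show "\<nu> j t \<ge> length (?L j)"
      using fe by (simp add: fully_efficient_def length_pred_line[OF fd])
  qed (simp add: window_def)
  then show ?thesis
    by (simp add: pred_served_def selected_def Let_def len flip: pred_total_def)
qed

context
  fixes sel D a \<mu> \<nu>
  assumes fe: "fully_efficient D a \<mu> \<nu>" and fd: "follows_discipline sel D a \<nu>"
begin

abbreviation "hat_line \<equiv>
  line sel (\<Sum>t<D. a t) (\<lambda>t. a (t + D)) (\<lambda>t. \<Sum>d\<in>window D. \<nu> d t)"

abbreviation "hat_served \<equiv>
  served sel (\<Sum>t<D. a t) (\<lambda>t. a (t + D)) (\<lambda>t. \<Sum>d\<in>window D. \<nu> d t)"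

abbreviation "hat_delay \<equiv>
  delay sel (\<Sum>t<D. a t) (\<lambda>t. a (t + D)) (\<lambda>t. \<Sum>d\<in>window D. \<nu> d t)"

text \<open>Relabelling preserves length and positions, which is all a discipline sees, so the same
  positions are served in both systems in every slot.\<close>

lemma pred_total_eq_map_line: "pred_total sel D a \<nu> t = map (true_packet D a) (hat_line t)"
proof (induction t)
  case 0
  have "map (true_packet D a) (map Initial [0..<\<Sum>t<D. a t]) =
      map ((!) (prefix_packets D a)) [0..<length (prefix_packets D a)]"
    by (simp add: length_prefix_packets)
  then show ?case by (simp add: pred_total_0 map_nth)
next
  case (Suc t)
  have "pred_total sel D a \<nu> (Suc t) = nths (pred_total sel D a \<nu> t)
      (- sel (length (pred_total sel D a \<nu> t))
        (min (\<Sum>d\<in>window D. \<nu> d t) (length (pred_total sel D a \<nu> t)))) @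
      batch (t + D) (a (t + D))"
    by (simp only: pred_total_Suc_filter pred_served_eq[OF fe fd]
        filter_notin_nths[OF distinct_pred_total])
  then show ?case
    by (simp add: Suc nths_map Let_def batch_def)
qed

lemma pred_served_eq_image: "pred_served sel D a \<nu> t = true_packet D a ` hat_served t"
  by (simp add: pred_served_eq[OF fe fd] pred_total_eq_map_line served_def Let_def nths_map)

lemma Arrival_mem_pred_served_iff:
  "Arrival (t + D) i \<in> pred_served sel D a \<nu> r \<longleftrightarrow> Arrival t i \<in> hat_served r"
proof -
  have "Arrival (t + D) i \<in> pred_served sel D a \<nu> r \<longleftrightarrow>
      (\<exists>x\<in>hat_served r. true_packet D a x = Arrival (t + D) i)"
    unfolding pred_served_eq_image by (auto simp: image_iff eq_commute)
  then show ?thesis by (simp add: true_packet_eq_Arrival_iff)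
qed

text \<open>Both systems serve the packet in the same slot \<open>r\<close>, and
  \<open>k > 0\<close> forces \<open>r > t + D\<close>, so it is served out of the actual queue. The
  value 0 is left out because it collects all delays up to \<open>D\<close> of the single
  queue.\<close>

lemma pred_delay_iff_hat_delay:
  assumes "k > 0"
  shows "pred_delay sel D a \<nu> (t + D) i k \<longleftrightarrow> hat_delay t i (k + D)"
proof -
  have actual: "Arrival (t + D) i \<in> set (pred_line sel D a \<nu> r (-1)) \<longleftrightarrow> t + D < r"
    if "Arrival t i \<in> hat_served r" for r
  proof (rule mem_actual_queue_iff)
    have "Arrival t i \<in> set (hat_line r)"
      using that by (auto simp: served_def Let_def dest: in_set_nthsD)
    then show "Arrival (t + D) i \<in> set (pred_total sel D a \<nu> r)"
      unfolding pred_total_eq_map_line by (force simp: image_iff)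
  qed
  show ?thesis
    unfolding pred_delay_def delay_def Arrival_mem_pred_served_iff
  proof
    assume "\<exists>r. Arrival t i \<in> hat_served r \<and>
      k = (if Arrival (t + D) i \<in> set (pred_line sel D a \<nu> r (-1)) then r - (t + D) else 0)"
    then obtain r where "Arrival t i \<in> hat_served r" "t + D < r" "k = r - (t + D)"
      using assms by (auto simp: actual split: if_splits)
    then show "\<exists>r\<ge>t. Arrival t i \<in> hat_served r \<and> k + D = r - t"
      by (intro exI[of _ r]) auto
  next
    assume "\<exists>r\<ge>t. Arrival t i \<in> hat_served r \<and> k + D = r - t"
    then obtain r where "r \<ge> t" "Arrival t i \<in> hat_served r" "k + D = r - t"
      by auto
    then show "\<exists>r. Arrival t i \<in> hat_served r \<and>
      k = (if Arrival (t + D) i \<in> set (pred_line sel D a \<nu> r (-1)) then r - (t + D) else 0)"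
      using assms by (intro exI[of _ r]) (auto simp: actual)
  qed
qed

end

section \<open>Long-run fractions\<close>

text \<open>The first \<open>D\<close> slots add fixed amounts to numerator and denominator; these
  are negligible because \<open>inf\<close> makes the denominator unbounded.\<close>

lemma delay_fraction_shift:
  assumes lim: "(\<lambda>T. delay_fraction (\<lambda>t. a (t + D)) dl' k' T) \<longlonglongrightarrow> l"
    and shift: "\<And>t i. dl (t + D) i k \<longleftrightarrow> dl' t i k'"
    and inf: "infinite {t. a t \<noteq> 0}"
  shows "(\<lambda>T. delay_fraction a dl k T) \<longlonglongrightarrow> l"
proof -
  \<comment> \<open>\<open>h\<close> and \<open>S\<close> are numerator and denominator of the
    shifted fraction, \<open>c\<close> and \<open>s\<close> the contributions of the first
    \<open>D\<close> slots.\<close>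
  define h where "h T = real (card {(t, i). t < T \<and> i < a (t + D) \<and> dl' t i k'})" for T
  define c where "c = real (card {(t, i). t < D \<and> i < a t \<and> dl t i k})"
  define S where "S T = real (\<Sum>t<T. a (t + D))" for T
  define s where "s = real (\<Sum>t<D. a t)"
  have finite_packets: "finite {(t, i). t < T \<and> i < b t \<and> Q t i}" for T and b :: "nat \<Rightarrow> nat" and Q
    by (rule finite_subset[of _ "SIGMA t:{..<T}. {..<b t}"]) auto
  have sum_shift: "(\<Sum>t<T + D. a t) = (\<Sum>t<D. a t) + (\<Sum>t<T. a (t + D))" for T
    by (induction T) auto
  have card_shift: "real (card {(t, i). t < T + D \<and> i < a t \<and> dl t i k}) = h T + c" for T
  proof -
    let ?B = "{(t, i). t < T \<and> i < a (t + D) \<and> dl' t i k'}"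
    have "{(t, i). t < T + D \<and> i < a t \<and> dl t i k} =
        (\<lambda>(t, i). (t + D, i)) ` ?B \<union> {(t, i). t < D \<and> i < a t \<and> dl t i k}" (is "?L = ?f ` _ \<union> ?C")
    proof
      show "?L \<subseteq> ?f ` ?B \<union> ?C"
      proof safe
        fix t i assume *: "t < T + D" "i < a t" "dl t i k" "(t, i) \<notin> ?f ` ?B"
        show "t < D"
        proof (rule ccontr)
          assume "\<not> t < D"
          then have "(t, i) = ?f (t - D, i)" "(t - D, i) \<in> ?B"
            using * shift[of "t - D" i] by auto
          with * show False by blast
        qed
      qed
    qed (auto simp: shift)
    moreover have "card (?f ` ?B) = card ?B"
      by (rule card_image) (auto simp: inj_on_def)
    moreover have "card (?f ` ?B \<union> ?C) = card (?f ` ?B) + card ?C"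
      by (intro card_Un_disjoint finite_imageI finite_packets) auto
    ultimately show ?thesis by (simp add: h_def c_def)
  qed
  have S_at_top: "filterlim S at_top sequentially"
    unfolding filterlim_at_top
  proof
    fix Z :: real
    define m where "m = nat \<lceil>Z\<rceil>"
    \<comment> \<open>Pick \<open>m \<ge> Z\<close> slots with arrivals from slot \<open>D\<close>
      on; each contributes at least one packet to \<open>S\<close>.\<close>
    have "infinite ({t. a t \<noteq> 0} - {..<D})" using inf by simp
    then obtain F where F: "F \<subseteq> {t. a t \<noteq> 0} - {..<D}" "finite F" "card F = m"
      by (meson infinite_arbitrarily_large)
    obtain K where K: "\<And>t. t \<in> F \<Longrightarrow> t < K"
      using F(2) finite_nat_set_iff_bounded by auto
    have "Z \<le> S T" if "T \<ge> K" for T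
    proof -
      have "card F \<le> (\<Sum>t\<in>F. a t)"
        using F sum_mono[of F "\<lambda>_. 1" a] by (force simp: Suc_le_eq)
      also have "\<dots> = (\<Sum>t\<in>(\<lambda>t. t - D) ` F. a (t + D))"
        using F by (subst sum.reindex) (auto simp: inj_on_def subset_iff not_less intro!: sum.cong,
            metis le_add_diff_inverse2)
      also have "\<dots> \<le> (\<Sum>t<T. a (t + D))"
        using K that by (intro sum_mono2) (auto intro: le_less_trans[OF diff_le_self] dest!: K)
      finally have "real m \<le> S T" using F(3) unfolding S_def by linarith
      then show ?thesis unfolding m_def by linarith
    qed
    then show "\<forall>\<^sub>F T in sequentially. Z \<le> S T"
      by (auto simp: eventually_sequentially)
  qed
  have "(\<lambda>T. s / S T) \<longlonglongrightarrow> 0" "(\<lambda>T. c / S T) \<longlonglongrightarrow> 0"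
    by (intro real_tendsto_divide_at_top[OF tendsto_const S_at_top])+
  moreover have "(\<lambda>T. h T / S T) \<longlonglongrightarrow> l"
    using lim by (simp add: delay_fraction_def h_def S_def)
  ultimately have "(\<lambda>T. (h T / S T + c / S T) / (1 + s / S T)) \<longlonglongrightarrow> (l + 0) / (1 + 0)"
    by (intro tendsto_intros) auto
  \<comment> \<open>Numerator and denominator are divided by \<open>S T\<close>, which is positive
    for all large \<open>T\<close>.\<close>
  moreover have "\<forall>\<^sub>F T in sequentially.
      (h T / S T + c / S T) / (1 + s / S T) = delay_fraction a dl k (T + D)"
    using filterlim_at_top_dense[THEN iffD1, OF S_at_top, rule_format, of 0]
  proof eventually_elim
    case (elim T)
    have "delay_fraction a dl k (T + D) = (h T + c) / (S T + s)"
      unfolding delay_fraction_def card_shift sum_shift S_def s_def by (simp add: add.commute)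
    also have "\<dots> = (h T / S T + c / S T) / (1 + s / S T)"
      using elim by (simp add: divide_simps)
    finally show ?case by simp
  qed
  ultimately have "(\<lambda>T. delay_fraction a dl k (T + D)) \<longlonglongrightarrow> l"
    using tendsto_cong by force
  then show ?thesis by (rule LIMSEQ_offset)
qed

section \<open>Almost sure properties of arrivals and delays\<close>

text \<open>Serves to extract one sample path from an almost sure statement.\<close>

lemma (in prob_space) ae_filter_neq_bot: "ae_filter M \<noteq> bot"
  by (simp add: ae_filter_eq_bot_iff emeasure_space_1)

lemma (in prob_space) steady_delay_nonneg:
  assumes "steady_delay M a dl p"
  shows "p k \<ge> 0"
proof -
  obtain \<omega> where "(\<lambda>T. delay_fraction (\<lambda>t. a t \<omega>) (dl \<omega>) k T) \<longlonglongrightarrow> p k"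
    using eventually_happens'[OF ae_filter_neq_bot assms[unfolded steady_delay_def]] by auto
  then show ?thesis
    by (rule LIMSEQ_le_const) (simp add: delay_fraction_def sum_nonneg)
qed

lemma iid_arrivals_measurable:
  assumes "prob_space M" "iid_arrivals M A Amax lam"
  shows "A n t \<in> M \<rightarrow>\<^sub>M count_space UNIV"
proof -
  have "(\<lambda>\<omega> n. A n t \<omega>) \<in> M \<rightarrow>\<^sub>M count_space UNIV"
    using assms by (auto simp: iid_arrivals_def prob_space.indep_vars_def2)
  then have "(\<lambda>f. f n) \<circ> (\<lambda>\<omega> n. A n t \<omega>) \<in> M \<rightarrow>\<^sub>M count_space UNIV"
    by (rule measurable_comp) simp
  then show ?thesis by (simp add: comp_def)
qed

lemma iid_arrivals_lam_nonneg:
  assumes "iid_arrivals M A Amax lam"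
  shows "lam n \<ge> 0"
proof -
  have "lam n = (\<integral>\<omega>. real (A n 0 \<omega>) \<partial>M)"
    using assms by (simp add: iid_arrivals_def)
  then show ?thesis by simp
qed

text \<open>
  If the arrivals stopped almost surely, dominated convergence would send their constant mean to 0.
\<close>

lemma iid_arrivals_not_AE_finite:
  assumes "prob_space M" "iid_arrivals M A Amax lam" "lam n > 0"
  shows "\<not> (AE \<omega> in M. finite {t. A n t \<omega> \<noteq> 0})"
proof
  interpret prob_space M by fact
  note [measurable] = iid_arrivals_measurable[OF assms(1,2)]
  assume fin: "AE \<omega> in M. finite {t. A n t \<omega> \<noteq> 0}"
  have "(\<lambda>t. \<integral>\<omega>. real (A n t \<omega>) \<partial>M) \<longlonglongrightarrow> (\<integral>\<omega>. 0 \<partial>M)"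
  proof (rule integral_dominated_convergence[where w = "\<lambda>_. real Amax"])
    show "AE \<omega> in M. (\<lambda>t. real (A n t \<omega>)) \<longlonglongrightarrow> 0"
      using fin
    proof eventually_elim
      case (elim \<omega>)
      then have "\<forall>\<^sub>F t in sequentially. A n t \<omega> = 0"
        by (simp flip: cofinite_eq_sequentially add: eventually_cofinite)
      then show ?case
        by (intro tendsto_eventually) (auto elim: eventually_mono)
    qed
    show "AE \<omega> in M. norm (real (A n t \<omega>)) \<le> real Amax" for t
      using assms(2) by (intro AE_I2) (auto simp: iid_arrivals_def)
  qed auto
  moreover have "(\<integral>\<omega>. real (A n t \<omega>) \<partial>M) = lam n" for t
    using assms(2) by (simp add: iid_arrivals_def)
  ultimately show False
    using assms(3) by (simp add: LIMSEQ_const_iff)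
qed

text \<open>
  The probabilities do not depend on the sample path, so one path on which all limits exist and
  arrivals never stop is enough.
\<close>

lemma pred_steady_delay_shift:
  assumes M: "prob_space M" and iid: "iid_arrivals M A Amax lam"
    and steady: "queue_steady_delay M (sel n) (\<lambda>_. 0) (A n) (\<mu> n) (p n)"
    and sys: "predictive_system M A \<mu> sel D \<nu> pD"
    and lam: "lam n > 0" and k: "k > 0"
  shows "pD n k = p n (k + D n)"
proof -
  let ?s = "\<lambda>t \<omega>. \<Sum>d\<in>window (D n). \<nu> n d t \<omega>"
  let ?q = "\<lambda>\<omega>. \<Sum>t<D n. A n t \<omega>"
  have fe: "fully_efficient (D n) (\<lambda>t. A n t \<omega>) (\<lambda>t. \<mu> n t \<omega>) (\<lambda>d t. \<nu> n d t \<omega>)"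
    and fd: "follows_discipline (sel n) (D n) (\<lambda>t. A n t \<omega>) (\<lambda>d t. \<nu> n d t \<omega>)"
    if "\<omega> \<in> space M" for \<omega>
    using sys that by (auto simp: predictive_system_def)
  \<comment> \<open>The rates add up to \<open>\<mu>\<close>, so the original queue is the single
    queue with service \<open>?s\<close>, empty at the start and without shift. Insensitivity then
    carries \<open>p n\<close> over to the backlog \<open>?q\<close> and the shift
    \<open>D n\<close>.\<close>
  have "AE \<omega> in M. (\<lambda>t. ?s t \<omega>) = (\<lambda>t. \<mu> n t \<omega>)"
    using fe by (intro AE_I2) (simp add: fully_efficient_def)
  then have "queue_steady_delay M (sel n) (\<lambda>_. 0) (\<lambda>t. A n (t + 0)) ?s (p n)"
    using steady unfolding queue_steady_delay_def steady_delay_def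
    by eventually_elim simp
  moreover have "?q \<in> M \<rightarrow>\<^sub>M count_space UNIV"
    using iid_arrivals_measurable[OF M iid] by measurable
  moreover have "queue_steady_delay M (sel n) (\<lambda>_. 0) (\<lambda>t. A n (t + 0)) ?s (p n) \<longleftrightarrow>
      queue_steady_delay M (sel n) ?q (\<lambda>t. A n (t + D n)) ?s (p n)"
    if "?q \<in> M \<rightarrow>\<^sub>M count_space UNIV"
  proof -
    have "insensitive_delay M (sel n) (D n) (A n) (\<nu> n)"
      using sys by (simp add: predictive_system_def)
    from this[unfolded insensitive_delay_def, THEN bspec, THEN bspec, THEN bspec, THEN bspec, THEN spec,
        of "\<lambda>_. 0" ?q 0 "D n" "p n"]
    show ?thesis using that by simp
  qed
  ultimately have "queue_steady_delay M (sel n) ?q (\<lambda>t. A n (t + D n)) ?s (p n)"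
    by blast
  then have hat: "AE \<omega> in M. \<forall>k. (\<lambda>T. delay_fraction (\<lambda>t. A n (t + D n) \<omega>)
      (delay (sel n) (?q \<omega>) (\<lambda>t. A n (t + D n) \<omega>) (\<lambda>t. ?s t \<omega>)) k T) \<longlonglongrightarrow> p n k"
    by (simp add: queue_steady_delay_def steady_delay_def)
  have pred: "AE \<omega> in M. \<forall>k. (\<lambda>T. delay_fraction (\<lambda>t. A n t \<omega>)
      (pred_delay (sel n) (D n) (\<lambda>t. A n t \<omega>) (\<lambda>d t. \<nu> n d t \<omega>)) k T) \<longlonglongrightarrow> pD n k"
    using sys by (simp add: predictive_system_def pred_steady_delay_def steady_delay_def)
  have "AE \<omega> in M. infinite {t. A n t \<omega> \<noteq> 0} \<longrightarrow> pD n k = p n (k + D n)"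
    using hat pred AE_space
  proof eventually_elim
    case (elim \<omega>)
    show ?case
    proof
      assume inf: "infinite {t. A n t \<omega> \<noteq> 0}"
      have "(\<lambda>T. delay_fraction (\<lambda>t. A n t \<omega>)
          (pred_delay (sel n) (D n) (\<lambda>t. A n t \<omega>) (\<lambda>d t. \<nu> n d t \<omega>)) k T) \<longlonglongrightarrow> p n (k + D n)"
        by (rule delay_fraction_shift[OF elim(1)[rule_format] _ inf])
          (rule pred_delay_iff_hat_delay[OF fe[OF elim(3)] fd[OF elim(3)] k])
      with elim(2) show "pD n k = p n (k + D n)"
        using LIMSEQ_unique by blast
    qed
  qed
  \<comment> \<open>The equation is between constants: if it failed, it would fail on every path,
    and the arrivals would stop almost surely.\<close>
  then have "AE \<omega> in M. finite {t. A n t \<omega> \<noteq> 0}" if "pD n k \<noteq> p n (k + D n)"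
    by eventually_elim (use that in blast)
  then show ?thesis
    using iid_arrivals_not_AE_finite[where A = A and n = n, OF M iid lam] by blast
qed

section \<open>Average delays\<close>

text \<open>Summability is asked only of users with positive rate: a weight 0 annihilates even an
  infinite mean delay.\<close>

lemma avg_delay_eq_ennreal:
  assumes lam: "\<And>n. lam n \<ge> 0" and p: "\<And>n k. p n k \<ge> 0"
    and sum: "\<And>n. lam n > 0 \<Longrightarrow> summable (\<lambda>k. real k * p n k)"
  shows "avg_delay lam p = ennreal ((\<Sum>n\<in>UNIV. lam n * (\<Sum>k. real k * p n k)) / (\<Sum>n\<in>UNIV. lam n))"
proof -
  have nonneg: "0 \<le> lam n * (\<Sum>k. real k * p n k)" for n
    using lam[of n] p sum[of n] by (cases "lam n = 0") (auto intro!: mult_nonneg_nonneg suminf_nonneg)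
  have "ennreal (lam n) * (\<Sum>k. of_nat k * ennreal (p n k)) =
      ennreal (lam n * (\<Sum>k. real k * p n k))" for n
  proof (cases "lam n = 0")
    case False
    then have "summable (\<lambda>k. real k * p n k)" using sum lam[of n] by simp
    then have "(\<Sum>k. ennreal (real k * p n k)) = ennreal (\<Sum>k. real k * p n k)"
      using p by (intro suminf_ennreal2) auto
    then show ?thesis
      using lam by (simp add: ennreal_mult' ennreal_of_nat_eq_real_of_nat p)
  qed simp
  then have "avg_delay lam p =
      ennreal (\<Sum>n\<in>UNIV. lam n * (\<Sum>k. real k * p n k)) / ennreal (\<Sum>n\<in>UNIV. lam n)"
    using nonneg by (simp add: avg_delay_def)
  also have "\<dots> = ennreal ((\<Sum>n\<in>UNIV. lam n * (\<Sum>k. real k * p n k)) / (\<Sum>n\<in>UNIV. lam n))"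
  proof (cases "(\<Sum>n\<in>UNIV. lam n) = 0")
    \<comment> \<open>If all rates vanish, both sides are 0 / 0, which is 0 in both types.\<close>
    case True
    then have "lam n = 0" for n
      using lam by (simp add: sum_nonneg_eq_0_iff)
    then show ?thesis by simp
  next
    case False
    then show ?thesis
      using lam nonneg by (intro divide_ennreal) (auto simp: sum_nonneg less_le)
  qed
  finally show ?thesis .
qed

text \<open>The denominator comes from a real and is finite, so a finite quotient forces a finite
  numerator; a positive weight passes finiteness on to the series.\<close>

lemma avg_delay_finite_summable:
  assumes lam: "\<And>n. lam n \<ge> 0" and p: "\<And>n k. p n k \<ge> 0"
    and fin: "avg_delay lam p < \<infinity>" and pos: "lam n > 0"
  shows "summable (\<lambda>k. real k * p n k)"
proof (rule summable_suminf_not_top)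
  have "(\<Sum>n\<in>UNIV. ennreal (lam n) * (\<Sum>k. of_nat k * ennreal (p n k))) \<noteq> top"
    using fin unfolding avg_delay_def
    by (metis ennreal_divide_eq_top_iff ennreal_neq_top infinity_ennreal_def less_irrefl)
  then have "ennreal (lam n) * (\<Sum>k. of_nat k * ennreal (p n k)) \<noteq> top"
    by (simp add: less_top)
  then show "(\<Sum>k. ennreal (real k * p n k)) \<noteq> top"
    using pos p by (simp add: ennreal_mult_eq_top_iff ennreal_mult' ennreal_of_nat_eq_real_of_nat)
qed (simp add: p)

section \<open>Mean excess of the delay over the window\<close>

text \<open>The mean of \<open>[w - d]^+\<close> for a delay \<open>w\<close> with distribution
  \<open>p\<close>, that is, the mean delay left by a window of size \<open>d\<close>.\<close>

definition excess_delay :: "(nat \<Rightarrow> real) \<Rightarrow> nat \<Rightarrow> real" where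
  "excess_delay p d = (\<Sum>k. real k * p (k + d))"

lemma excess_delay_0: "excess_delay p 0 = (\<Sum>k. real k * p k)"
  by (simp add: excess_delay_def)

context
  fixes p :: "nat \<Rightarrow> real"
  assumes p: "\<And>k. p k \<ge> 0" and sum: "summable (\<lambda>k. real k * p k)"
begin

lemma summable_excess_delay: "summable (\<lambda>k. real k * p (k + d))"
proof (rule summable_comparison_test')
  show "summable (\<lambda>k. real (k + d) * p (k + d))"
    using sum summable_iff_shift[of "\<lambda>k. real k * p k" d] by simp
qed (simp add: p mult_right_mono)

text \<open>The mean of \<open>w - [w - d]^+ = min(w, d)\<close>: delays up to \<open>d\<close>
  disappear, larger ones shrink by \<open>d\<close>.\<close>

lemma excess_delay_diff:
  "excess_delay p 0 - excess_delay p d =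
    (\<Sum>k=1..d. real k * p k) + real d * (\<Sum>k. p (Suc k + d))"
proof -
  have tail: "summable (\<lambda>k. real (Suc k) * p (Suc k + d))"
    using summable_excess_delay[of d] summable_Suc_iff[of "\<lambda>k. real k * p (k + d)"] by simp
  then have tail': "summable (\<lambda>k. p (Suc k + d))"
    by (rule summable_comparison_test') (simp add: p mult_le_cancel_right1 not_less algebra_simps)
  have "excess_delay p 0 =
      (\<Sum>k. real (k + Suc d) * p (k + Suc d)) + (\<Sum>k<Suc d. real k * p k)"
    unfolding excess_delay_0 by (rule suminf_split_initial_segment[OF sum])
  also have "(\<Sum>k<Suc d. real k * p k) = (\<Sum>k=1..d. real k * p k)"
    by (rule sum.mono_neutral_right) auto
  \<comment> \<open>A delay \<open>k + d + 1\<close> splits into its excess \<open>k + 1\<close> and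
    the window \<open>d\<close>.\<close>
  also have "(\<Sum>k. real (k + Suc d) * p (k + Suc d)) =
      (\<Sum>k. real (Suc k) * p (Suc k + d) + real d * p (Suc k + d))"
    by (simp add: algebra_simps)
  also have "\<dots> = (\<Sum>k. real (Suc k) * p (Suc k + d)) + real d * (\<Sum>k. p (Suc k + d))"
    using suminf_add[OF tail summable_mult[OF tail', of "real d"]] suminf_mult[OF tail', of "real d"]
    by simp
  also have "(\<Sum>k. real (Suc k) * p (Suc k + d)) = excess_delay p d"
    unfolding excess_delay_def using suminf_split_head[OF summable_excess_delay[of d]] by simp
  finally show ?thesis by simp
qed

text \<open>The excess lies between 0 and the tail of the convergent series for the mean delay,
  since \<open>k \<le> k + d\<close> termwise.\<close>

lemma excess_delay_tendsto_0: "excess_delay p \<longlonglongrightarrow> 0"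
proof -
  let ?f = "\<lambda>k. real k * p k"
  have "(\<lambda>d. (\<Sum>k. ?f k) - (\<Sum>k<d. ?f k)) \<longlonglongrightarrow> (\<Sum>k. ?f k) - (\<Sum>k. ?f k)"
    by (intro tendsto_intros summable_LIMSEQ sum)
  then have tail: "(\<lambda>d. \<Sum>k. ?f (k + d)) \<longlonglongrightarrow> 0"
    by (simp only: suminf_minus_initial_segment[OF sum] diff_self)
  have upper: "\<forall>\<^sub>F d in sequentially. excess_delay p d \<le> (\<Sum>k. ?f (k + d))"
    unfolding excess_delay_def using summable_excess_delay sum p
    by (intro always_eventually allI suminf_le mult_right_mono)
      (auto simp del: of_nat_add simp: summable_iff_shift[of ?f])
  have lower: "\<forall>\<^sub>F d in sequentially. 0 \<le> excess_delay p d"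
    unfolding excess_delay_def using summable_excess_delay p
    by (intro always_eventually allI suminf_nonneg) auto
  show ?thesis
    by (rule tendsto_sandwich[OF lower upper tendsto_const tail])
qed

end

lemma filterlim_window: "filterlim (\<lambda>D :: 'u::finite \<Rightarrow> nat. D n) at_top at_top"
  unfolding filterlim_at_top eventually_at_top_windows by auto

theorem theorem5:
  fixes M :: "'w measure"
    and A \<mu> :: "'u::finite \<Rightarrow> nat \<Rightarrow> 'w \<Rightarrow> nat"
    and Amax :: nat
    and lam :: "'u \<Rightarrow> real"
    and sel :: "'u \<Rightarrow> nat \<Rightarrow> nat \<Rightarrow> nat set"
    and p :: "'u \<Rightarrow> nat \<Rightarrow> real"
    and \<nu> :: "('u \<Rightarrow> nat) \<Rightarrow> 'u \<Rightarrow> int \<Rightarrow> nat \<Rightarrow> 'w \<Rightarrow> nat"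
    and pD :: "('u \<Rightarrow> nat) \<Rightarrow> 'u \<Rightarrow> nat \<Rightarrow> real"
  assumes "prob_space M"
    and "iid_arrivals M A Amax lam"
    and "\<And>n t. \<mu> n t \<in> M \<rightarrow>\<^sub>M count_space UNIV"
    and "\<And>n. discipline (sel n)"
    and "\<And>n. queue_steady_delay M (sel n) (\<lambda>_. 0) (A n) (\<mu> n) (p n)"
    and "avg_delay lam p < \<infinity>"
  shows "(\<forall>D. predictive_system M A \<mu> sel D (\<nu> D) (pD D) \<longrightarrow>
            avg_delay lam (pD D) < \<infinity> \<and>
            delay_reduction lam p (pD D) =
              (\<Sum>n\<in>UNIV. lam n * ((\<Sum>k=1..D n. real k * p n k) + real (D n) * (\<Sum>k. p n (Suc k + D n)))) /
              (\<Sum>n\<in>UNIV. lam n))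
       \<and> ((\<forall>D. predictive_system M A \<mu> sel D (\<nu> D) (pD D)) \<longrightarrow>
            ((\<lambda>D. avg_delay lam (pD D)) \<longlongrightarrow> 0) at_top \<and>
            ((\<lambda>D. delay_reduction lam p (pD D)) \<longlongrightarrow> enn2real (avg_delay lam p)) at_top)"
proof -
  interpret prob_space M by fact
  note lam = iid_arrivals_lam_nonneg[OF assms(2)]
  have p: "p n k \<ge> 0" for n k
    using assms(5)[of n] by (auto simp: queue_steady_delay_def intro: steady_delay_nonneg)
  note sum = avg_delay_finite_summable[OF lam p assms(6)]
  \<comment> \<open>The average delay as a real function of the window vector;
    \<open>W (\<lambda>_. 0)\<close> belongs to the original system.\<close>
  define W where "W D = (\<Sum>n\<in>UNIV. lam n * excess_delay (p n) (D n)) / (\<Sum>n\<in>UNIV. lam n)"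
    for D :: "'u \<Rightarrow> nat"
  have W_nonneg: "0 \<le> W D" for D
    unfolding W_def excess_delay_def
  proof (intro divide_nonneg_nonneg sum_nonneg)
    fix n
    show "0 \<le> lam n * (\<Sum>k. real k * p n (k + D n))"
      using lam[of n] summable_excess_delay[OF p sum, of n "D n"] p
      by (cases "lam n = 0") (auto intro!: mult_nonneg_nonneg suminf_nonneg)
  qed (simp_all add: lam)
  have avg_p: "avg_delay lam p = ennreal (W (\<lambda>_. 0))"
    using avg_delay_eq_ennreal[of lam p, OF lam p sum] by (simp add: W_def excess_delay_0)
  have avg_pD: "avg_delay lam (pD D) = ennreal (W D)"
    if sys: "predictive_system M A \<mu> sel D (\<nu> D) (pD D)" for D
  proof -
    have pD: "pD D n k \<ge> 0" for n k
      using sys by (auto simp: predictive_system_def pred_steady_delay_def intro: steady_delay_nonneg)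
    \<comment> \<open>At \<open>k = 0\<close> the two probabilities may differ, but the factor
      \<open>k\<close> hides this; users of rate 0 are left out and have weight 0 in the
      average.\<close>
    have eq: "(\<lambda>k. real k * pD D n k) = (\<lambda>k. real k * p n (k + D n))" if "lam n > 0" for n
    proof
      fix k
      show "real k * pD D n k = real k * p n (k + D n)"
        using pred_steady_delay_shift[where p = p, OF assms(1,2,5) sys that, of k] by (cases "k = 0") auto
    qed
    have "avg_delay lam (pD D) =
        ennreal ((\<Sum>n\<in>UNIV. lam n * (\<Sum>k. real k * pD D n k)) / (\<Sum>n\<in>UNIV. lam n))"
      by (rule avg_delay_eq_ennreal[OF lam pD]) (simp add: eq summable_excess_delay[OF p sum])
    moreover have "lam n * (\<Sum>k. real k * pD D n k) = lam n * excess_delay (p n) (D n)" for n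
      using lam[of n] eq[of n] by (cases "lam n = 0") (auto simp: excess_delay_def)
    ultimately show ?thesis by (simp add: W_def)
  qed
  have reduction: "delay_reduction lam p (pD D) = W (\<lambda>_. 0) - W D"
    if "predictive_system M A \<mu> sel D (\<nu> D) (pD D)" for D
    using avg_pD[OF that] by (simp add: delay_reduction_def avg_p W_nonneg)
  have W_diff: "W (\<lambda>_. 0) - W D =
      (\<Sum>n\<in>UNIV. lam n * ((\<Sum>k=1..D n. real k * p n k) + real (D n) * (\<Sum>k. p n (Suc k + D n)))) /
      (\<Sum>n\<in>UNIV. lam n)" for D
  proof -
    have "lam n * excess_delay (p n) 0 - lam n * excess_delay (p n) (D n) =
        lam n * ((\<Sum>k=1..D n. real k * p n k) + real (D n) * (\<Sum>k. p n (Suc k + D n)))" for n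
      using lam[of n] excess_delay_diff[OF p sum, of n "D n"]
      by (cases "lam n = 0") (auto simp flip: right_diff_distrib)
    then show ?thesis
      by (simp add: W_def flip: diff_divide_distrib sum_subtractf)
  qed
  have W_lim: "(W \<longlongrightarrow> 0) at_top"
  proof -
    have "((\<lambda>D. lam n * excess_delay (p n) (D n)) \<longlongrightarrow> 0) at_top" for n
    proof (cases "lam n = 0")
      case False
      then have "excess_delay (p n) \<longlonglongrightarrow> 0"
        using lam[of n] excess_delay_tendsto_0[OF p sum] by simp
      then show ?thesis
        by (intro tendsto_mult_right_zero filterlim_compose[OF _ filterlim_window])
    qed simp
    then have "((\<lambda>D. \<Sum>n\<in>UNIV. lam n * excess_delay (p n) (D n)) \<longlongrightarrow> 0) at_top"
      by (rule tendsto_null_sum)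
    then show ?thesis
      unfolding W_def by (rule tendsto_divide_zero)
  qed
  show ?thesis
  proof (intro conjI allI impI)
    fix D assume sys: "predictive_system M A \<mu> sel D (\<nu> D) (pD D)"
    show "avg_delay lam (pD D) < \<infinity>"
      by (simp add: avg_pD[OF sys])
    show "delay_reduction lam p (pD D) =
        (\<Sum>n\<in>UNIV. lam n * ((\<Sum>k=1..D n. real k * p n k) + real (D n) * (\<Sum>k. p n (Suc k + D n)))) /
        (\<Sum>n\<in>UNIV. lam n)"
      using reduction[OF sys] W_diff by simp
  next
    assume sys: "\<forall>D. predictive_system M A \<mu> sel D (\<nu> D) (pD D)"
    show "((\<lambda>D. avg_delay lam (pD D)) \<longlongrightarrow> 0) at_top"
      using tendsto_ennrealI[OF W_lim] by (simp add: avg_pD sys)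
    show "((\<lambda>D. delay_reduction lam p (pD D)) \<longlongrightarrow> enn2real (avg_delay lam p)) at_top"
      using tendsto_diff[OF tendsto_const W_lim, of "W (\<lambda>_. 0)"]
      by (simp add: reduction sys avg_p W_nonneg)
  qed
qed

end
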